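(* Let $R$ be a commutative ring with $1\neq 0$ and let $S$ be a multiplicatively closed subset of $R$. The following statements are equivalent. (1) $\mathrm{Spec}_SR$ is a noetherian space with respect to the $S$-flat topology. (2) The open subsets of $\mathrm{Spec}_SR$ with respect to the $S$-flat topology are exactly the sets $V_S(I)$ where $I$ runs through the set of finitely generated ideals of $R$. (3) For every prime ideal $P$ of $R$ disjoint from $S$, $\Lambda(P)=D_S(f)$ for some $f\in R$. (4) Any arbitrary intersection of $S$-Zariski open subsets of $\mathrm{Spec}_SR$ is $S$-Zariski open.
   Context: A multiplicatively closed subset $S$ of $R$ satisfies $0\notin S$, $1\in S$, and $ss'\in S$ for all $s,s'\in S$. An ideal $P$ of $R$ is $S$-prime if $P\cap S=\emptyset$ and there exists $s\in S$ such that for all $a,b\in R$, $ab\in P$ implies $sa\in P$ or $sb\in P$. $\mathrm{Spec}_SR$ is the set of all $S$-prime ideals of $R$. For $E\subseteq R$, $V_S(E)=\{P\in\mathrm{Spec}_SR : sE\subseteq P \text{ for some } s\in S\}$; write $V_S(f)=V_S(\{f\})$ and $D_S(f)=\mathrm{Spec}_SR\setminus V_S(f)$. The $S$-Zariski topology on $\mathrm{Spec}_SR$ is the topology whose closed sets are the sets $V_S(I)$, $I$ an ideal of $R$. The $S$-flat topology on $\mathrm{Spec}_SR$ is the topology having the sets $V_S(f)$, $f\in R$, as a sub-basis of open sets. For $P\in\mathrm{Spec}_SR$, $\Lambda(P)$ denotes the closure of $\{P\}$ in the $S$-flat topology. A space is noetherian if its open sets satisfy the ascending chain condition (equivalently,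 every open subset is quasi-compact). *)

theory Defs
  imports "HOL-Analysis.Abstract_Topology" "HOL-Algebra.Ideal"
begin

definition mult_closed_subset :: "('a, 'b) ring_scheme \<Rightarrow> 'a set \<Rightarrow> bool"
  where "mult_closed_subset R S \<longleftrightarrow> submonoid S R \<and> \<zero>\<^bsub>R\<^esub> \<notin> S"

definition S_prime_ideal :: "('a, 'b) ring_scheme \<Rightarrow> 'a set \<Rightarrow> 'a set \<Rightarrow> bool"
  where "S_prime_ideal R S P \<longleftrightarrow>
    ideal P R \<and> P \<inter> S = {} \<and>
    (\<exists>s\<in>S. \<forall>a\<in>carrier R. \<forall>b\<in>carrier R.
       a \<otimes>\<^bsub>R\<^esub> b \<in> P \<longrightarrow> s \<otimes>\<^bsub>R\<^esub> a \<in> P \<or> s \<otimes>\<^bsub>R\<^esub> b \<in> P)"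

definition S_Spec :: "('a, 'b) ring_scheme \<Rightarrow> 'a set \<Rightarrow> 'a set set"
  where "S_Spec R S = {P. S_prime_ideal R S P}"

definition V_S :: "('a, 'b) ring_scheme \<Rightarrow> 'a set \<Rightarrow> 'a set \<Rightarrow> 'a set set"
  where "V_S R S E = {P \<in> S_Spec R S. \<exists>s\<in>S. s <#\<^bsub>R\<^esub> E \<subseteq> P}"

definition D_S :: "('a, 'b) ring_scheme \<Rightarrow> 'a set \<Rightarrow> 'a \<Rightarrow> 'a set set"
  where "D_S R S f = S_Spec R S - V_S R S {f}"

definition S_Zariski_open :: "('a, 'b) ring_scheme \<Rightarrow> 'a set \<Rightarrow> 'a set set \<Rightarrow> bool"
  where "S_Zariski_open R S U \<longleftrightarrow> (\<exists>I. ideal I R \<and> U = S_Spec R S - V_S R S I)"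

definition S_Zariski_topology :: "('a, 'b) ring_scheme \<Rightarrow> 'a set \<Rightarrow> 'a set topology"
  where "S_Zariski_topology R S = topology (S_Zariski_open R S)"

definition S_flat_topology :: "('a, 'b) ring_scheme \<Rightarrow> 'a set \<Rightarrow> 'a set topology"
  where "S_flat_topology R S = topology_generated_by ((\<lambda>f. V_S R S {f}) ` carrier R)"

definition Lambda_S :: "('a, 'b) ring_scheme \<Rightarrow> 'a set \<Rightarrow> 'a set \<Rightarrow> 'a set set"
  where "Lambda_S R S P = S_flat_topology R S closure_of {P}"

definition noetherian_space :: "'a topology \<Rightarrow> bool"
  where "noetherian_space X \<longleftrightarrow>
    (\<forall>U :: nat \<Rightarrow> 'a set. (\<forall>n. openin X (U n)) \<and> (\<forall>n. U n \<subseteq> U (Suc n)) \<longrightarrow>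
       (\<exists>N. \<forall>n\<ge>N. U n = U N))"

definition fg_ideal :: "('a, 'b) ring_scheme \<Rightarrow> 'a set \<Rightarrow> bool"
  where "fg_ideal R I \<longleftrightarrow> (\<exists>A \<subseteq> carrier R. finite A \<and> I = genideal R A)"

text \<open>The two topologies are well defined: the sets \<open>V_S R S I\<close> are the closed sets of a
  topology, and both topologies have \<open>S_Spec R S\<close> as underlying set.\<close>

context
  fixes R :: "('a, 'b) ring_scheme" (structure) and S
  assumes cr: "cring R" and mc: "mult_closed_subset R S"
begin

interpretation cring R by (fact cr)

lemma S_facts: "S \<subseteq> carrier R" "\<one> \<in> S" "x \<in> S \<Longrightarrow> y \<in> S \<Longrightarrow> x \<otimes> y \<in> S" "\<zero> \<notin> S"
  using mc unfolding mult_closed_subset_def by (auto dest: submonoid.subset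
      submonoid.one_closed submonoid.m_closed)

lemma V_S_iff_witness:
  assumes "S_prime_ideal R S P"
  obtains t where "t \<in> S" "ideal {a \<in> carrier R. t \<otimes> a \<in> P} R"
    "\<one> \<notin> {a \<in> carrier R. t \<otimes> a \<in> P}"
    "\<And>a b. a \<in> carrier R \<Longrightarrow> b \<in> carrier R \<Longrightarrow> t \<otimes> (a \<otimes> b) \<in> P \<Longrightarrow> t \<otimes> a \<in> P \<or> t \<otimes> b \<in> P"
    "\<And>E. E \<subseteq> carrier R \<Longrightarrow> P \<in> V_S R S E \<longleftrightarrow> E \<subseteq> {a \<in> carrier R. t \<otimes> a \<in> P}"
proof -
  have id: "ideal P R" and dis: "P \<inter> S = {}"
    using assms unfolding S_prime_ideal_def by auto
  obtain t where t: "t \<in> S" and tp: "\<And>a b. a \<in> carrier R \<Longrightarrow> b \<in> carrier R \<Longrightarrow> a \<otimes> b \<in> P \<Longrightarrow>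
      t \<otimes> a \<in> P \<or> t \<otimes> b \<in> P"
    using assms unfolding S_prime_ideal_def by blast
  interpret P: ideal P R by (fact id)
  have tc: "t \<in> carrier R" using t S_facts by blast
  have strong: "t \<otimes> a \<in> P" if "s \<in> S" "a \<in> carrier R" "s \<otimes> a \<in> P" for s a
  proof -
    have "t \<otimes> s \<notin> P" using dis t that S_facts by blast
    then show ?thesis using tp[of s a] that S_facts by blast
  qed
  have 1: "ideal {a \<in> carrier R. t \<otimes> a \<in> P} R"
  proof (rule idealI)
    show "subgroup {a \<in> carrier R. t \<otimes> a \<in> P} (add_monoid R)"
    proof (rule add.subgroupI)
      show "{a \<in> carrier R. t \<otimes> a \<in> P} \<noteq> {}" using tc P.zero_closed by auto
      show "\<ominus> a \<in> {a \<in> carrier R. t \<otimes> a \<in> P}" if "a \<in> {a \<in> carrier R. t \<otimes> a \<in> P}" for a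
        using that tc by (simp add: r_minus)
    qed (use tc in \<open>auto simp: r_distr\<close>)
  next
    fix a x assume a: "a \<in> {a \<in> carrier R. t \<otimes> a \<in> P}" "x \<in> carrier R"
    have "x \<otimes> (t \<otimes> a) \<in> P" using a P.I_l_closed by simp
    moreover have "x \<otimes> (t \<otimes> a) = t \<otimes> (x \<otimes> a)" using a tc by (simp add: m_lcomm)
    ultimately show "x \<otimes> a \<in> {a \<in> carrier R. t \<otimes> a \<in> P}" using a by simp
    then show "a \<otimes> x \<in> {a \<in> carrier R. t \<otimes> a \<in> P}" using a by (simp add: m_comm)
  qed (rule ring_axioms)
  have 2: "\<one> \<notin> {a \<in> carrier R. t \<otimes> a \<in> P}" using t tc dis by auto
  have 3: "t \<otimes> a \<in> P \<or> t \<otimes> b \<in> P"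
    if ab: "a \<in> carrier R" "b \<in> carrier R" "t \<otimes> (a \<otimes> b) \<in> P" for a b
  proof -
    have "(t \<otimes> a) \<otimes> b \<in> P" using ab tc by (simp add: m_assoc)
    then have "t \<otimes> (t \<otimes> a) \<in> P \<or> t \<otimes> b \<in> P" using tp ab tc by simp
    then show ?thesis using strong[of "t \<otimes> t" a] S_facts(3)[OF t t] ab tc by (auto simp: m_assoc)
  qed
  have 4: "P \<in> V_S R S E \<longleftrightarrow> E \<subseteq> {a \<in> carrier R. t \<otimes> a \<in> P}" if "E \<subseteq> carrier R" for E
    using that t strong assms unfolding V_S_def S_Spec_def l_coset_def by blast
  show thesis using that t 1 2 3 4 by blast
qed

lemma V_S_subset: "V_S R S E \<subseteq> S_Spec R S"
  unfolding V_S_def by blast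

lemma V_S_zero: "V_S R S {\<zero>} = S_Spec R S"
proof -
  have "P \<in> V_S R S {\<zero>}" if "P \<in> S_Spec R S" for P
  proof -
    have "S_prime_ideal R S P" using that unfolding S_Spec_def by simp
    then obtain t where I: "ideal {a \<in> carrier R. t \<otimes> a \<in> P} R"
      and V: "\<And>E. E \<subseteq> carrier R \<Longrightarrow> P \<in> V_S R S E \<longleftrightarrow> E \<subseteq> {a \<in> carrier R. t \<otimes> a \<in> P}"
      by (rule V_S_iff_witness) blast
    show ?thesis using V[of "{\<zero>}"] additive_subgroup.zero_closed[OF ideal.axioms(1)[OF I]] by simp
  qed
  then show ?thesis using V_S_subset by blast
qed

lemma V_S_carrier: "V_S R S (carrier R) = {}"
proof -
  have "P \<notin> V_S R S (carrier R)" if "P \<in> S_Spec R S" for P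
  proof -
    have "S_prime_ideal R S P" using that unfolding S_Spec_def by simp
    then obtain t where "\<one> \<notin> {a \<in> carrier R. t \<otimes> a \<in> P}"
      and V: "\<And>E. E \<subseteq> carrier R \<Longrightarrow> P \<in> V_S R S E \<longleftrightarrow> E \<subseteq> {a \<in> carrier R. t \<otimes> a \<in> P}"
      by (rule V_S_iff_witness) blast
    then show ?thesis using V[of "carrier R"] one_closed by blast
  qed
  then show ?thesis using V_S_subset by blast
qed

lemma V_S_inter:
  assumes "ideal I R" "ideal J R"
  shows "V_S R S (I \<inter> J) = V_S R S I \<union> V_S R S J"
proof -
  have sub: "I \<subseteq> carrier R" "J \<subseteq> carrier R"
    using assms by (auto dest: ideal.Icarr)
  have "P \<in> V_S R S (I \<inter> J) \<longleftrightarrow> P \<in> V_S R S I \<or> P \<in> V_S R S J" if "P \<in> S_Spec R S" for P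
  proof -
    have "S_prime_ideal R S P" using that unfolding S_Spec_def by simp
    then obtain t where
      pr: "\<And>a b. a \<in> carrier R \<Longrightarrow> b \<in> carrier R \<Longrightarrow> t \<otimes> (a \<otimes> b) \<in> P \<Longrightarrow> t \<otimes> a \<in> P \<or> t \<otimes> b \<in> P"
      and V: "\<And>E. E \<subseteq> carrier R \<Longrightarrow> P \<in> V_S R S E \<longleftrightarrow> E \<subseteq> {a \<in> carrier R. t \<otimes> a \<in> P}"
      by (rule V_S_iff_witness) blast
    have IJ: "a \<otimes> b \<in> I \<inter> J" if "a \<in> I" "b \<in> J" for a b
      using that ideal.I_l_closed[OF assms(2)] ideal.I_r_closed[OF assms(1)] sub by blast
    have "I \<inter> J \<subseteq> {a \<in> carrier R. t \<otimes> a \<in> P} \<longleftrightarrow>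
        I \<subseteq> {a \<in> carrier R. t \<otimes> a \<in> P} \<or> J \<subseteq> {a \<in> carrier R. t \<otimes> a \<in> P}"
    proof (intro iffI)
      assume l: "I \<inter> J \<subseteq> {a \<in> carrier R. t \<otimes> a \<in> P}"
      show "I \<subseteq> {a \<in> carrier R. t \<otimes> a \<in> P} \<or> J \<subseteq> {a \<in> carrier R. t \<otimes> a \<in> P}"
      proof (rule ccontr)
        assume "\<not> ?thesis"
        then obtain a b where "a \<in> I" "b \<in> J" "t \<otimes> a \<notin> P" "t \<otimes> b \<notin> P"
          using sub by auto
        then show False using l IJ[of a b] pr[of a b] sub by auto
      qed
    qed auto
    moreover have "I \<inter> J \<subseteq> carrier R" using sub by blast
    ultimately show ?thesis by (simp only: V sub)
  qed
  then show ?thesis using V_S_subset by blast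
qed

lemma V_S_genideal_Union:
  assumes "\<And>I. I \<in> \<I> \<Longrightarrow> ideal I R"
  shows "V_S R S (Idl (\<Union>\<I>)) = S_Spec R S \<inter> (\<Inter>I\<in>\<I>. V_S R S I)"
proof -
  have sub: "\<Union>\<I> \<subseteq> carrier R" using assms by (auto dest: ideal.Icarr)
  have sub': "Idl (\<Union>\<I>) \<subseteq> carrier R"
    using genideal_ideal[OF sub] by (auto dest: ideal.Icarr)
  have "P \<in> V_S R S (Idl (\<Union>\<I>)) \<longleftrightarrow> (\<forall>I\<in>\<I>. P \<in> V_S R S I)" if "P \<in> S_Spec R S" for P
  proof -
    have "S_prime_ideal R S P" using that unfolding S_Spec_def by simp
    then obtain t where I: "ideal {a \<in> carrier R. t \<otimes> a \<in> P} R"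
      and V: "\<And>E. E \<subseteq> carrier R \<Longrightarrow> P \<in> V_S R S E \<longleftrightarrow> E \<subseteq> {a \<in> carrier R. t \<otimes> a \<in> P}"
      by (rule V_S_iff_witness) blast
    have "P \<in> V_S R S (Idl (\<Union>\<I>)) \<longleftrightarrow> \<Union>\<I> \<subseteq> {a \<in> carrier R. t \<otimes> a \<in> P}"
      unfolding V[OF sub'] using genideal_minimal[OF I] genideal_self[OF sub] by blast
    also have "\<dots> \<longleftrightarrow> (\<forall>I\<in>\<I>. P \<in> V_S R S I)"
    proof -
      have "P \<in> V_S R S I \<longleftrightarrow> I \<subseteq> {a \<in> carrier R. t \<otimes> a \<in> P}" if "I \<in> \<I>" for I
        using V[of I] that sub by blast
      then show ?thesis by (simp add: Sup_le_iff)
    qed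
    finally show ?thesis .
  qed
  then show ?thesis using V_S_subset by blast
qed

lemma istopology_S_Zariski_open: "istopology (S_Zariski_open R S)"
  unfolding istopology_def
proof (intro conjI allI impI)
  fix U W assume "S_Zariski_open R S U" "S_Zariski_open R S W"
  then obtain I J where I: "ideal I R" "U = S_Spec R S - V_S R S I"
    and J: "ideal J R" "W = S_Spec R S - V_S R S J"
    unfolding S_Zariski_open_def by blast
  have "U \<inter> W = S_Spec R S - V_S R S (I \<inter> J)"
    using I J V_S_inter by blast
  then show "S_Zariski_open R S (U \<inter> W)"
    unfolding S_Zariski_open_def using i_intersect[OF I(1) J(1)] by blast
next
  fix \<U> assume a: "\<forall>U\<in>\<U>. S_Zariski_open R S U"
  define \<I> where "\<I> = {I. ideal I R \<and> S_Spec R S - V_S R S I \<in> \<U>}"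
  have id: "\<And>I. I \<in> \<I> \<Longrightarrow> ideal I R" unfolding \<I>_def by blast
  have "\<Union>\<I> \<subseteq> carrier R" using id by (auto dest: ideal.Icarr)
  then have "ideal (Idl (\<Union>\<I>)) R" by (rule genideal_ideal)
  moreover have "\<Union>\<U> = S_Spec R S - V_S R S (Idl (\<Union>\<I>))"
  proof -
    have "U \<in> (\<lambda>I. S_Spec R S - V_S R S I) ` \<I>" if U: "U \<in> \<U>" for U
    proof -
      obtain I where "ideal I R" "U = S_Spec R S - V_S R S I"
        using a U unfolding S_Zariski_open_def by metis
      then show ?thesis using U unfolding \<I>_def by simp
    qed
    then have "\<U> = (\<lambda>I. S_Spec R S - V_S R S I) ` \<I>"
      unfolding \<I>_def by auto
    then have "\<Union>\<U> = (\<Union>I\<in>\<I>. S_Spec R S - V_S R S I)" by simp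
    also have "\<dots> = S_Spec R S - (S_Spec R S \<inter> (\<Inter>I\<in>\<I>. V_S R S I))" by auto
    finally show ?thesis using V_S_genideal_Union[OF id] by simp
  qed
  ultimately show "S_Zariski_open R S (\<Union>\<U>)"
    unfolding S_Zariski_open_def by blast
qed

lemma openin_S_Zariski: "openin (S_Zariski_topology R S) U \<longleftrightarrow> S_Zariski_open R S U"
  unfolding S_Zariski_topology_def topology_inverse'[OF istopology_S_Zariski_open] ..

lemma topspace_S_Zariski: "topspace (S_Zariski_topology R S) = S_Spec R S"
proof (rule antisym)
  have "S_Zariski_open R S (S_Spec R S)"
    unfolding S_Zariski_open_def 
    by (rule exI[of _ "carrier R"]) (simp add: oneideal V_S_carrier)
  then show "S_Spec R S \<subseteq> topspace (S_Zariski_topology R S)"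
    unfolding openin_S_Zariski[symmetric] by (rule openin_subset)
  have "S_Zariski_open R S (topspace (S_Zariski_topology R S))"
    unfolding openin_S_Zariski[symmetric] by (rule openin_topspace)
  then show "topspace (S_Zariski_topology R S) \<subseteq> S_Spec R S"
    unfolding S_Zariski_open_def by auto
qed

lemma topspace_S_flat: "topspace (S_flat_topology R S) = S_Spec R S"
  unfolding S_flat_topology_def topology_generated_by_topspace
proof (rule antisym)
  show "\<Union>((\<lambda>f. V_S R S {f}) ` carrier R) \<subseteq> S_Spec R S"
    by (rule UN_least) (rule V_S_subset)
  show "S_Spec R S \<subseteq> \<Union>((\<lambda>f. V_S R S {f}) ` carrier R)"
    using UN_upper[OF zero_closed, of "\<lambda>f. V_S R S {f}"] unfolding V_S_zero .
qed

end

end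

theory Submission
  imports Defs "HOL-Algebra.Ring_Divisibility"
begin

text \<open>Every \<open>S\<close>-prime ideal \<open>P\<close> has a prime ideal \<open>Q = (P : t)\<close> disjoint from \<open>S\<close> attached to it, and
  \<open>P\<close> lies in \<open>V\<^sub>S(E)\<close> exactly when \<open>E \<subseteq> Q\<close>.  Hence both topologies are pulled back from the ordinary
  Zariski and flat topologies on the set of primes disjoint from \<open>S\<close>, and the theorem is about the
  latter: flat open sets are unions of sets \<open>V\<^sub>S(A)\<close> with \<open>A\<close> finite, and \<open>\<Lambda>(Q)\<close> is the set of points
  whose prime is contained in \<open>Q\<close>.

  The one nontrivial ingredient is a compactness property (\<open>V_S_compact\<close>): a Zariski closed set covered
  by sets \<open>V\<^sub>S(A)\<close>, with \<open>A\<close> ranging over a product-closed family of finite sets, is contained in one of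
  them.  Since \<open>V\<^sub>S(AB) = V\<^sub>S(A) \<union> V\<^sub>S(B)\<close>, product-closed families correspond to directed covers.
  It replaces compactness of the constructible topology, and it comes from Krull's argument: an ideal
  maximal among those containing \<open>J\<close> and containing no member of a product-closed family of finite
  sets is prime.

  The four conditions are then proved in a cycle.  In a noetherian space an open set that is not basic
  would give a strictly increasing chain of basic open sets inside it.  If all flat open sets are
  basic, the complement of \<open>\<Lambda>(Q)\<close>, which is the union of the \<open>V\<^sub>S(f)\<close> with \<open>f \<notin> Q\<close>, is a Zariski closed
  set, so by compactness it is one of these \<open>V\<^sub>S(f)\<close>.  If every \<open>\<Lambda>(Q)\<close> is some \<open>D\<^sub>S(f)\<close>, any
  intersection of Zariski open sets is open, because together with a point it contains the
  corresponding \<open>\<Lambda>(Q)\<close>.  Finally, if Zariski open sets are stable under intersections, all flat open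
  sets are Zariski closed, so compactness applies to the union of an ascending chain of them.\<close>

section \<open>Prime ideals avoiding a product-closed family of finite sets\<close>

text \<open>With singletons \<open>{s}\<close> for \<open>s\<close> in a multiplicative set this is Krull's prime existence theorem.  The
  members are finite so that a member contained in the union of a chain of ideals already lies in one
  of them, which is what Zorn's lemma requires.\<close>

lemma (in cring) prime_avoiding_product_closed_family:
  assumes J: "ideal J R" and ne: "F \<noteq> {}"
    and fin: "\<And>A. A \<in> F \<Longrightarrow> finite A" and carr: "\<And>A. A \<in> F \<Longrightarrow> A \<subseteq> carrier R"
    and mult: "\<And>A B. A \<in> F \<Longrightarrow> B \<in> F \<Longrightarrow> A <#> B \<in> F"
    and avoid: "\<And>A. A \<in> F \<Longrightarrow> \<not> A \<subseteq> J"
  obtains Q where "primeideal Q R" "J \<subseteq> Q" "\<And>A. A \<in> F \<Longrightarrow> \<not> A \<subseteq> Q"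
proof -
  define \<A> where "\<A> = {I. ideal I R \<and> J \<subseteq> I \<and> (\<forall>A\<in>F. \<not> A \<subseteq> I)}"
  have "\<exists>Q\<in>\<A>. \<forall>I\<in>\<A>. Q \<subseteq> I \<longrightarrow> I = Q"
  proof (rule subset_Zorn_nonempty)
    show "\<A> \<noteq> {}" using J avoid unfolding \<A>_def by blast
  next
    fix C assume C: "C \<noteq> {}" "subset.chain \<A> C"
    have ch: "subset.chain {I. ideal I R} C"
      using C(2) unfolding \<A>_def subset.chain_def by blast
    have "ideal (\<Union>C) R" using chain_Union_is_ideal[OF ch] C(1) by simp
    moreover have "J \<subseteq> \<Union>C"
      using C unfolding \<A>_def subset.chain_def by blast
    moreover have "\<not> A \<subseteq> \<Union>C" if A: "A \<in> F" for A
    proof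
      assume "A \<subseteq> \<Union>C"
      then obtain I where "I \<in> C" "A \<subseteq> I"
        using finite_subset_Union_chain[OF fin[OF A] _ C] by blast
      then show False using C(2) A unfolding \<A>_def subset.chain_def by blast
    qed
    ultimately show "\<Union>C \<in> \<A>" unfolding \<A>_def by blast
  qed
  then obtain Q where Q: "Q \<in> \<A>" and max: "\<And>I. I \<in> \<A> \<Longrightarrow> Q \<subseteq> I \<Longrightarrow> I = Q" by blast
  have idQ: "ideal Q R" and JQ: "J \<subseteq> Q" and avQ: "\<And>A. A \<in> F \<Longrightarrow> \<not> A \<subseteq> Q"
    using Q unfolding \<A>_def by auto
  interpret Q: ideal Q R by (fact idQ)
  \<comment> \<open>By maximality of \<open>Q\<close>, adjoining an element outside \<open>Q\<close> produces an ideal containing some member.\<close>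
  have larger: "\<exists>A\<in>F. A \<subseteq> Q <+>\<^bsub>R\<^esub> PIdl a" if a: "a \<in> carrier R" "a \<notin> Q" for a
  proof (rule ccontr)
    assume no: "\<not> ?thesis"
    have idP: "ideal (PIdl a) R" using a cgenideal_ideal by blast
    have sum: "Q <+>\<^bsub>R\<^esub> PIdl a = Idl (Q \<union> PIdl a)"
      using union_genideal[OF idQ idP] by simp
    have sub: "Q \<union> PIdl a \<subseteq> carrier R"
      using Q.Icarr ideal.Icarr[OF idP] by blast
    have up: "Q \<union> PIdl a \<subseteq> Q <+>\<^bsub>R\<^esub> PIdl a" unfolding sum by (rule genideal_self[OF sub])
    have "Q <+>\<^bsub>R\<^esub> PIdl a \<in> \<A>"
      using add_ideals[OF idQ idP] up JQ no unfolding \<A>_def by blast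
    then have "Q <+>\<^bsub>R\<^esub> PIdl a = Q" using max up by blast
    then show False using up cgenideal_self[OF a(1)] a(2) by blast
  qed
  have "primeideal Q R"
  proof (rule primeidealI[OF idQ is_cring])
    show "carrier R \<noteq> Q" using ne carr avQ by blast
  next
    fix a b assume a: "a \<in> carrier R" and b: "b \<in> carrier R" and ab: "a \<otimes> b \<in> Q"
    show "a \<in> Q \<or> b \<in> Q"
    proof (rule ccontr)
      assume "\<not> ?thesis"
      then obtain A B where A: "A \<in> F" "A \<subseteq> Q <+>\<^bsub>R\<^esub> PIdl a" and B: "B \<in> F" "B \<subseteq> Q <+>\<^bsub>R\<^esub> PIdl b"
        using larger a b by meson
      have "x \<otimes> y \<in> Q" if x: "x \<in> Q <+>\<^bsub>R\<^esub> PIdl a" and y: "y \<in> Q <+>\<^bsub>R\<^esub> PIdl b" for x y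
      proof -
        obtain p r where p: "p \<in> Q" "r \<in> carrier R" "x = p \<oplus> r \<otimes> a"
          using x unfolding set_add_def' cgenideal_def by auto
        obtain q s where q: "q \<in> Q" "s \<in> carrier R" "y = q \<oplus> s \<otimes> b"
          using y unfolding set_add_def' cgenideal_def by auto
        have pc: "p \<in> carrier R" and qc: "q \<in> carrier R" using p q Q.Icarr by auto
        have "x \<otimes> y = p \<otimes> y \<oplus> ((r \<otimes> a) \<otimes> q \<oplus> (r \<otimes> s) \<otimes> (a \<otimes> b))"
          unfolding p(3) q(3) using pc qc p(2) q(2) a b by algebra
        moreover have "p \<otimes> y \<in> Q" using p(1) q qc b by (simp add: Q.I_r_closed)
        moreover have "(r \<otimes> a) \<otimes> q \<in> Q" using q(1) p(2) a by (simp add: Q.I_l_closed)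
        moreover have "(r \<otimes> s) \<otimes> (a \<otimes> b) \<in> Q" using ab p(2) q(2) by (simp add: Q.I_l_closed)
        ultimately show ?thesis by (simp add: Q.a_closed)
      qed
      then have "A <#> B \<subseteq> Q" using A(2) B(2) unfolding set_mult_def by blast
      then show False using avQ mult A(1) B(1) by blast
    qed
  qed
  then show thesis using that JQ avQ by blast
qed

section \<open>\<open>S\<close>-prime ideals and prime ideals disjoint from \<open>S\<close>\<close>

locale mult_closed_cring = cring R for R :: "('a, 'b) ring_scheme" (structure) +
  fixes S :: "'a set"
  assumes mult_closed: "mult_closed_subset R S"
begin

lemmas S_carrier = S_facts(1)[OF is_cring mult_closed]
  and S_one = S_facts(2)[OF is_cring mult_closed]
  and S_mult = S_facts(3)[OF is_cring mult_closed]

text \<open>The prime is \<open>(P : t)\<close>, where \<open>t\<close> witnesses that \<open>P\<close> is \<open>S\<close>-prime.\<close>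

lemma S_prime_associated_prime:
  assumes P: "P \<in> S_Spec R S"
  obtains Q where "primeideal Q R" "Q \<inter> S = {}"
    "\<And>E. E \<subseteq> carrier R \<Longrightarrow> P \<in> V_S R S E \<longleftrightarrow> E \<subseteq> Q"
proof -
  have sp: "S_prime_ideal R S P" using P unfolding S_Spec_def by simp
  obtain t where t: "t \<in> S" and id: "ideal {a \<in> carrier R. t \<otimes> a \<in> P} R"
    and one: "\<one> \<notin> {a \<in> carrier R. t \<otimes> a \<in> P}"
    and pr: "\<And>a b. a \<in> carrier R \<Longrightarrow> b \<in> carrier R \<Longrightarrow> t \<otimes> (a \<otimes> b) \<in> P \<Longrightarrow> t \<otimes> a \<in> P \<or> t \<otimes> b \<in> P"
    and V: "\<And>E. E \<subseteq> carrier R \<Longrightarrow> P \<in> V_S R S E \<longleftrightarrow> E \<subseteq> {a \<in> carrier R. t \<otimes> a \<in> P}"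
    by (rule V_S_iff_witness[OF is_cring mult_closed sp]) blast
  have "primeideal {a \<in> carrier R. t \<otimes> a \<in> P} R"
  proof (rule primeidealI[OF id is_cring])
    show "carrier R \<noteq> {a \<in> carrier R. t \<otimes> a \<in> P}" using one one_closed by blast
  qed (use pr in auto)
  moreover have "{a \<in> carrier R. t \<otimes> a \<in> P} \<inter> S = {}"
    using sp S_mult[OF t] unfolding S_prime_ideal_def by blast
  ultimately show thesis using that V by blast
qed

lemma prime_in_S_Spec:
  assumes Q: "primeideal Q R" "Q \<inter> S = {}"
  shows "Q \<in> S_Spec R S"
proof -
  interpret Q: primeideal Q R by (fact Q(1))
  have "\<forall>a\<in>carrier R. \<forall>b\<in>carrier R. a \<otimes> b \<in> Q \<longrightarrow> \<one> \<otimes> a \<in> Q \<or> \<one> \<otimes> b \<in> Q"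
    by (metis Q.I_prime l_one)
  then show ?thesis unfolding S_Spec_def S_prime_ideal_def
    using Q.ideal_axioms Q(2) S_one by blast
qed

lemma prime_in_V_S_iff:
  assumes Q: "primeideal Q R" "Q \<inter> S = {}" and E: "E \<subseteq> carrier R"
  shows "Q \<in> V_S R S E \<longleftrightarrow> E \<subseteq> Q"
proof
  interpret Q: primeideal Q R by (fact Q(1))
  show "E \<subseteq> Q" if V: "Q \<in> V_S R S E"
  proof
    fix x assume x: "x \<in> E"
    obtain s where "s \<in> S" "s <#\<^bsub>R\<^esub> E \<subseteq> Q" using V unfolding V_S_def by blast
    then have "s \<otimes> x \<in> Q" "s \<notin> Q" using x Q(2) unfolding l_coset_def by auto
    then show "x \<in> Q" using Q.I_prime[of s x] S_carrier \<open>s \<in> S\<close> E x by blast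
  qed
  show "Q \<in> V_S R S E" if "E \<subseteq> Q"
  proof -
    have "\<one> <#\<^bsub>R\<^esub> E = E" using E unfolding l_coset_def by force
    then show ?thesis using that S_one prime_in_S_Spec[OF Q] unfolding V_S_def by auto
  qed
qed

section \<open>Algebra of the sets \<open>V\<^sub>S(E)\<close>\<close>

lemma V_S_subset_S_Spec: "V_S R S E \<subseteq> S_Spec R S"
  unfolding V_S_def by blast

lemma in_V_S_iff_elements:
  assumes P: "P \<in> S_Spec R S" and E: "E \<subseteq> carrier R"
  shows "P \<in> V_S R S E \<longleftrightarrow> (\<forall>f\<in>E. P \<in> V_S R S {f})"
proof -
  obtain Q where V: "\<And>E. E \<subseteq> carrier R \<Longrightarrow> P \<in> V_S R S E \<longleftrightarrow> E \<subseteq> Q"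
    using S_prime_associated_prime[OF P] by metis
  have "P \<in> V_S R S {f} \<longleftrightarrow> f \<in> Q" if "f \<in> E" for f using V[of "{f}"] that E by auto
  then show ?thesis using V[OF E] by blast
qed

lemma V_S_Un:
  assumes A: "A \<subseteq> carrier R" and B: "B \<subseteq> carrier R"
  shows "V_S R S (A \<union> B) = V_S R S A \<inter> V_S R S B"
proof -
  have "P \<in> V_S R S (A \<union> B) \<longleftrightarrow> P \<in> V_S R S A \<and> P \<in> V_S R S B" if P: "P \<in> S_Spec R S" for P
  proof -
    have AB: "A \<union> B \<subseteq> carrier R" using A B by simp
    show ?thesis unfolding in_V_S_iff_elements[OF P A] in_V_S_iff_elements[OF P B]
        in_V_S_iff_elements[OF P AB] by (rule ball_Un)
  qed
  then show ?thesis using V_S_subset_S_Spec by blast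
qed

lemma V_S_set_mult:
  assumes A: "A \<subseteq> carrier R" and B: "B \<subseteq> carrier R"
  shows "V_S R S (A <#> B) = V_S R S A \<union> V_S R S B"
proof -
  have "P \<in> V_S R S (A <#> B) \<longleftrightarrow> P \<in> V_S R S A \<or> P \<in> V_S R S B" if P: "P \<in> S_Spec R S" for P
  proof -
    obtain Q where Q: "primeideal Q R"
      and V: "\<And>E. E \<subseteq> carrier R \<Longrightarrow> P \<in> V_S R S E \<longleftrightarrow> E \<subseteq> Q"
      using S_prime_associated_prime[OF P] by metis
    interpret Q: primeideal Q R by (fact Q)
    have "a \<otimes> b \<in> Q \<longleftrightarrow> a \<in> Q \<or> b \<in> Q" if "a \<in> A" "b \<in> B" for a b
      using that A B Q.I_prime Q.I_l_closed Q.I_r_closed by blast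
    then have "A <#> B \<subseteq> Q \<longleftrightarrow> A \<subseteq> Q \<or> B \<subseteq> Q"
      unfolding set_mult_def by blast
    then show ?thesis using V A B set_mult_closed[OF A B] by simp
  qed
  then show ?thesis using V_S_subset_S_Spec by blast
qed

lemma V_S_genideal:
  assumes A: "A \<subseteq> carrier R"
  shows "V_S R S (Idl A) = V_S R S A"
proof -
  have sub: "Idl A \<subseteq> carrier R" using genideal_ideal[OF A] by (auto dest: ideal.Icarr)
  have "P \<in> V_S R S (Idl A) \<longleftrightarrow> P \<in> V_S R S A" if P: "P \<in> S_Spec R S" for P
  proof -
    obtain Q where Q: "primeideal Q R"
      and V: "\<And>E. E \<subseteq> carrier R \<Longrightarrow> P \<in> V_S R S E \<longleftrightarrow> E \<subseteq> Q"
      using S_prime_associated_prime[OF P] by metis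
    have "Idl A \<subseteq> Q \<longleftrightarrow> A \<subseteq> Q"
      using genideal_self[OF A] genideal_minimal[OF primeideal.axioms(1)[OF Q]] by blast
    then show ?thesis using V A sub by simp
  qed
  then show ?thesis using V_S_subset_S_Spec by blast
qed

lemma V_S_empty: "V_S R S {} = S_Spec R S"
  using S_one unfolding V_S_def l_coset_def by blast

lemma V_S_one: "V_S R S {\<one>} = {}"
  using V_S_genideal[of "{\<one>}"] genideal_one V_S_carrier[OF is_cring mult_closed] by simp

lemma V_S_fg_ideals: "{V_S R S I | I. fg_ideal R I} = {V_S R S A | A. finite A \<and> A \<subseteq> carrier R}"
  unfolding fg_ideal_def using V_S_genideal by blast

text \<open>Multiplying each member of the family by the elements of \<open>S\<close> makes the avoiding prime disjoint from
  \<open>S\<close>, hence a point of \<open>V\<^sub>S(J)\<close>; if this enlarged family cannot be avoided, some \<open>sA\<close> lies in \<open>J\<close>, and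
  then \<open>V\<^sub>S(J) \<subseteq> V\<^sub>S(A)\<close>.\<close>

lemma V_S_compact:
  assumes J: "ideal J R" and ne: "F \<noteq> {}"
    and fin: "\<And>A. A \<in> F \<Longrightarrow> finite A" and carr: "\<And>A. A \<in> F \<Longrightarrow> A \<subseteq> carrier R"
    and mult: "\<And>A B. A \<in> F \<Longrightarrow> B \<in> F \<Longrightarrow> A <#> B \<in> F"
    and cover: "V_S R S J \<subseteq> (\<Union>A\<in>F. V_S R S A)"
  shows "\<exists>A\<in>F. V_S R S J \<subseteq> V_S R S A"
proof (cases "\<exists>s\<in>S. \<exists>A\<in>F. s <#\<^bsub>R\<^esub> A \<subseteq> J")
  case True
  then obtain s A where s: "s \<in> S" and A: "A \<in> F" and sA: "s <#\<^bsub>R\<^esub> A \<subseteq> J" by blast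
  have "P \<in> V_S R S A" if P: "P \<in> V_S R S J" for P
  proof -
    obtain t where t: "t \<in> S" "t <#\<^bsub>R\<^esub> J \<subseteq> P" using P unfolding V_S_def by blast
    have "(t \<otimes> s) <#\<^bsub>R\<^esub> A \<subseteq> P"
    proof
      fix x assume "x \<in> (t \<otimes> s) <#\<^bsub>R\<^esub> A"
      then obtain a where a: "a \<in> A" "x = (t \<otimes> s) \<otimes> a" unfolding l_coset_def by blast
      then have "x = t \<otimes> (s \<otimes> a)" using t(1) s carr[OF A] S_carrier by (auto simp: m_assoc subset_iff)
      moreover have "s \<otimes> a \<in> J" using sA a unfolding l_coset_def by blast
      ultimately show "x \<in> P" using t(2) unfolding l_coset_def by blast
    qed
    then show ?thesis using P S_mult[OF t(1) s] unfolding V_S_def by blast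
  qed
  then show ?thesis using A by blast
next
  case False
  define G where "G = {s <#\<^bsub>R\<^esub> A | s A. s \<in> S \<and> A \<in> F}"
  have "\<exists>Q. primeideal Q R \<and> J \<subseteq> Q \<and> (\<forall>B\<in>G. \<not> B \<subseteq> Q)"
  proof (rule prime_avoiding_product_closed_family[OF J, of G])
    show "G \<noteq> {}" using ne S_one unfolding G_def by blast
    show "finite B" if "B \<in> G" for B using that fin unfolding G_def l_coset_def by auto
    show "B \<subseteq> carrier R" if "B \<in> G" for B
      using that carr S_carrier unfolding G_def l_coset_def by (auto simp: subset_iff)
    show "\<not> B \<subseteq> J" if "B \<in> G" for B using that False unfolding G_def by blast
    show "B <#> C \<in> G" if BC: "B \<in> G" "C \<in> G" for B C
    proof -
      obtain s A where s: "s \<in> S" "A \<in> F" "B = s <#\<^bsub>R\<^esub> A" using BC(1) unfolding G_def by blast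
      obtain t A' where t: "t \<in> S" "A' \<in> F" "C = t <#\<^bsub>R\<^esub> A'" using BC(2) unfolding G_def by blast
      have "(s \<otimes> a) \<otimes> (t \<otimes> a') = (s \<otimes> t) \<otimes> (a \<otimes> a')" if "a \<in> A" "a' \<in> A'" for a a'
      proof -
        have "s \<in> carrier R" "t \<in> carrier R" "a \<in> carrier R" "a' \<in> carrier R"
          using s t that carr S_carrier by auto
        then show ?thesis by (simp add: m_ac)
      qed
      then have "B <#> C = (s \<otimes> t) <#\<^bsub>R\<^esub> (A <#> A')"
        unfolding s(3) t(3) l_coset_def set_mult_def by auto
      then show ?thesis using S_mult mult s t unfolding G_def by blast
    qed
  qed blast
  then obtain Q where Q: "primeideal Q R" "J \<subseteq> Q" "\<And>B. B \<in> G \<Longrightarrow> \<not> B \<subseteq> Q" by blast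
  interpret Q: primeideal Q R by (fact Q(1))
  have mulQ: False if s: "s \<in> S" and A: "A \<in> F" and sA: "s \<in> Q \<or> A \<subseteq> Q" for s A
  proof -
    have "s \<otimes> a \<in> Q" if a: "a \<in> A" for a
    proof -
      have "s \<in> carrier R" "a \<in> carrier R" using s a S_carrier carr[OF A] by auto
      then show ?thesis using sA a Q.I_l_closed Q.I_r_closed by (auto simp: subset_iff)
    qed
    then have "s <#\<^bsub>R\<^esub> A \<subseteq> Q" unfolding l_coset_def by auto
    moreover have "s <#\<^bsub>R\<^esub> A \<in> G" using s A unfolding G_def by blast
    ultimately show False using Q(3) by simp
  qed
  have dis: "Q \<inter> S = {}"
  proof -
    obtain A where "A \<in> F" using ne by blast
    then show ?thesis using mulQ[of _ A] by auto
  qed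
  have "J \<subseteq> carrier R" using J by (auto dest: ideal.Icarr)
  then have "Q \<in> V_S R S J" using prime_in_V_S_iff[OF Q(1) dis] Q(2) by simp
  then obtain A where A: "A \<in> F" "Q \<in> V_S R S A" using cover by blast
  then have "A \<subseteq> Q" using prime_in_V_S_iff[OF Q(1) dis carr[OF A(1)]] by simp
  then have False using mulQ[OF S_one A(1)] by simp
  then show ?thesis ..
qed

section \<open>The two topologies\<close>

lemma topspace_flat: "topspace (S_flat_topology R S) = S_Spec R S"
  by (rule topspace_S_flat[OF is_cring mult_closed])

lemma openin_flat_V_S:
  assumes "finite A" "A \<subseteq> carrier R"
  shows "openin (S_flat_topology R S) (V_S R S A)"
  using assms
proof (induction A)
  case empty
  show ?case unfolding V_S_empty topspace_flat[symmetric] by (rule openin_topspace)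
next
  case (insert a A)
  have "V_S R S (insert a A) = V_S R S {a} \<inter> V_S R S A"
    using V_S_Un[of "{a}" A] insert.prems by simp
  moreover have "openin (S_flat_topology R S) (V_S R S {a})"
    unfolding S_flat_topology_def using insert.prems by (intro topology_generated_by_Basis) auto
  ultimately show ?case using insert by (simp add: openin_Int)
qed

lemma flat_open_basis:
  assumes U: "openin (S_flat_topology R S) U" and P: "P \<in> U"
  obtains A where "finite A" "A \<subseteq> carrier R" "P \<in> V_S R S A" "V_S R S A \<subseteq> U"
proof -
  have "generate_topology_on ((\<lambda>f. V_S R S {f}) ` carrier R) U"
    using openin_topology_generated_by[OF U[unfolded S_flat_topology_def]] .
  then have "\<forall>P\<in>U. \<exists>A. finite A \<and> A \<subseteq> carrier R \<and> P \<in> V_S R S A \<and> V_S R S A \<subseteq> U"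
  proof induction
    case (Int U W)
    show ?case
    proof
      fix P assume P: "P \<in> U \<inter> W"
      obtain A where A: "finite A" "A \<subseteq> carrier R" "P \<in> V_S R S A" "V_S R S A \<subseteq> U"
        using Int.IH(1) P by auto
      obtain B where B: "finite B" "B \<subseteq> carrier R" "P \<in> V_S R S B" "V_S R S B \<subseteq> W"
        using Int.IH(2) P by auto
      have "V_S R S (A \<union> B) = V_S R S A \<inter> V_S R S B"
        by (rule V_S_Un[OF A(2) B(2)])
      then show "\<exists>A. finite A \<and> A \<subseteq> carrier R \<and> P \<in> V_S R S A \<and> V_S R S A \<subseteq> U \<inter> W"
        using A B by (intro exI[of _ "A \<union> B"]) auto
    qed
  next
    case (UN K)
    show ?case
    proof
      fix P assume "P \<in> \<Union>K"
      then obtain U where U: "U \<in> K" "P \<in> U" by (rule UnionE)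
      then obtain A where "finite A" "A \<subseteq> carrier R" "P \<in> V_S R S A" "V_S R S A \<subseteq> U"
        using UN.IH[OF U(1)] by auto
      then show "\<exists>A. finite A \<and> A \<subseteq> carrier R \<and> P \<in> V_S R S A \<and> V_S R S A \<subseteq> \<Union>K"
        using U(1) by (intro exI[of _ A]) auto
    qed
  next
    case (Basis U)
    then obtain f where "f \<in> carrier R" "U = V_S R S {f}" by auto
    then show ?case by (intro ballI exI[of _ "{f}"]) auto
  qed simp
  then show thesis using P that by auto
qed

text \<open>The closure of a prime consists of its generizations: the points whose prime lies below it.\<close>

lemma Lambda_S_prime:
  assumes Q: "primeideal Q R" "Q \<inter> S = {}"
  shows "Lambda_S R S Q = S_Spec R S - (\<Union>f\<in>carrier R - Q. V_S R S {f})"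
proof -
  have "P \<in> Lambda_S R S Q \<longleftrightarrow> (\<forall>f\<in>carrier R - Q. P \<notin> V_S R S {f})" if P: "P \<in> S_Spec R S" for P
  proof
    assume L: "P \<in> Lambda_S R S Q"
    show "\<forall>f\<in>carrier R - Q. P \<notin> V_S R S {f}"
    proof (intro ballI notI)
      fix f assume f: "f \<in> carrier R - Q" "P \<in> V_S R S {f}"
      then have "Q \<in> V_S R S {f}"
        using L openin_flat_V_S[of "{f}"] unfolding Lambda_S_def in_closure_of by auto
      then show False using prime_in_V_S_iff[OF Q, of "{f}"] f by auto
    qed
  next
    assume r: "\<forall>f\<in>carrier R - Q. P \<notin> V_S R S {f}"
    have "Q \<in> U" if U: "openin (S_flat_topology R S) U" "P \<in> U" for U
    proof -
      obtain A where A: "finite A" "A \<subseteq> carrier R" "P \<in> V_S R S A" "V_S R S A \<subseteq> U"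
        by (rule flat_open_basis[OF U])
      have "f \<in> Q" if "f \<in> A" for f using that A(2,3) in_V_S_iff_elements[OF P A(2)] r by auto
      then have "Q \<in> V_S R S A" using prime_in_V_S_iff[OF Q A(2)] by auto
      then show ?thesis using A(4) by auto
    qed
    then show "P \<in> Lambda_S R S Q"
      unfolding Lambda_S_def in_closure_of topspace_flat using P by blast
  qed
  moreover have "Lambda_S R S Q \<subseteq> S_Spec R S"
    unfolding Lambda_S_def using closure_of_subset_topspace topspace_flat by metis
  ultimately show ?thesis by blast
qed

lemma openin_Zariski_iff:
  "openin (S_Zariski_topology R S) U \<longleftrightarrow> (\<exists>E. E \<subseteq> carrier R \<and> U = S_Spec R S - V_S R S E)"
proof -
  have "I \<subseteq> carrier R" if "ideal I R" for I using that by (auto dest: ideal.Icarr)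
  then have "(\<exists>I. ideal I R \<and> U = S_Spec R S - V_S R S I) \<longleftrightarrow>
      (\<exists>E. E \<subseteq> carrier R \<and> U = S_Spec R S - V_S R S E)"
    using V_S_genideal genideal_ideal by metis
  then show ?thesis
    unfolding openin_S_Zariski[OF is_cring mult_closed] S_Zariski_open_def .
qed

lemma openin_Zariski_D_S: "f \<in> carrier R \<Longrightarrow> openin (S_Zariski_topology R S) (D_S R S f)"
  unfolding openin_Zariski_iff D_S_def by (intro exI[of _ "{f}"]) simp

section \<open>The cycle of implications\<close>

lemma noetherian_flat_open_is_basic:
  assumes noeth: "noetherian_space (S_flat_topology R S)" and U: "openin (S_flat_topology R S) U"
  shows "\<exists>A. finite A \<and> A \<subseteq> carrier R \<and> U = V_S R S A"
proof (rule ccontr)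
  assume no: "\<not> ?thesis"
  define inU where "inU A \<longleftrightarrow> finite A \<and> A \<subseteq> carrier R \<and> V_S R S A \<subseteq> U" for A
  have step: "\<exists>B. inU B \<and> V_S R S A \<subset> V_S R S B" if A: "inU A" for A
  proof -
    have "V_S R S A \<noteq> U" using no A unfolding inU_def by blast
    then obtain P where P: "P \<in> U" "P \<notin> V_S R S A" using A unfolding inU_def by blast
    obtain B where B: "finite B" "B \<subseteq> carrier R" "P \<in> V_S R S B" "V_S R S B \<subseteq> U"
      by (rule flat_open_basis[OF U P(1)])
    have AB: "V_S R S (A <#> B) = V_S R S A \<union> V_S R S B"
      using A B unfolding inU_def by (intro V_S_set_mult) auto
    have "finite (A <#> B)" using A B unfolding inU_def set_mult_def by auto
    then have "inU (A <#> B)"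
      using A B set_mult_closed[of A B] AB unfolding inU_def by auto
    then show ?thesis using AB P B by blast
  qed
  \<comment> \<open>\<open>V\<^sub>S(1)\<close> is empty, so the chain can start there.\<close>
  have start: "inU {\<one>}" unfolding inU_def by (simp add: V_S_one)
  have "\<exists>W. \<forall>n. inU (W n) \<and> V_S R S (W n) \<subset> V_S R S (W (Suc n))"
  proof (rule dependent_nat_choice)
    show "\<exists>A. inU A" using start by (rule exI)
    show "\<exists>B. inU B \<and> V_S R S A \<subset> V_S R S B" if "inU A" for A and n :: nat
      using that by (rule step)
  qed
  then obtain W where W: "\<And>n. inU (W n)" "\<And>n::nat. V_S R S (W n) \<subset> V_S R S (W (Suc n))"
    by metis
  have "openin (S_flat_topology R S) (V_S R S (W n))" for n
    using W(1)[of n] openin_flat_V_S unfolding inU_def by simp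
  moreover have "V_S R S (W n) \<subseteq> V_S R S (W (Suc n))" for n using W(2)[of n] by simp
  ultimately obtain N where N: "\<And>n. n \<ge> N \<Longrightarrow> V_S R S (W n) = V_S R S (W N)"
    using noeth[unfolded noetherian_space_def, rule_format, of "\<lambda>n. V_S R S (W n)"] by auto
  have "V_S R S (W (Suc N)) = V_S R S (W N)" by (rule N) simp
  then show False using W(2)[of N] by simp
qed

text \<open>Compactness is used for the family of all \<open>{f}\<close> with \<open>f \<notin> Q\<close>; it is closed under products
  because \<open>Q\<close> is prime.\<close>

lemma flat_opens_basic_imp_Lambda_principal:
  assumes basic: "\<And>U. openin (S_flat_topology R S) U \<Longrightarrow>
      \<exists>A. finite A \<and> A \<subseteq> carrier R \<and> U = V_S R S A"
    and Q: "primeideal Q R" "Q \<inter> S = {}"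
  shows "\<exists>f\<in>carrier R. Lambda_S R S Q = D_S R S f"
proof -
  interpret Q: primeideal Q R by (fact Q(1))
  define F where "F = (\<lambda>f. {f}) ` (carrier R - Q)"
  have F: "(\<Union>A\<in>F. V_S R S A) = (\<Union>f\<in>carrier R - Q. V_S R S {f})"
    unfolding F_def by simp
  have op: "openin (S_flat_topology R S) (\<Union>A\<in>F. V_S R S A)"
    unfolding F_def by (intro openin_Union) (auto intro: openin_flat_V_S)
  obtain A where A: "A \<subseteq> carrier R" "(\<Union>A\<in>F. V_S R S A) = V_S R S A"
    using basic[OF op] by metis
  then have U: "(\<Union>A\<in>F. V_S R S A) = V_S R S (Idl A)" using V_S_genideal by simp
  have "\<exists>B\<in>F. V_S R S (Idl A) \<subseteq> V_S R S B"
  proof (rule V_S_compact[OF genideal_ideal[OF A(1)]])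
    show "F \<noteq> {}" unfolding F_def using Q.I_notcarr Q.a_subset by auto
    show "B <#> C \<in> F" if "B \<in> F" "C \<in> F" for B C
      using that Q.I_prime unfolding F_def set_mult_def by auto
    show "V_S R S (Idl A) \<subseteq> (\<Union>A\<in>F. V_S R S A)" using U by simp
  qed (auto simp: F_def)
  then obtain f where f: "f \<in> carrier R - Q" "V_S R S (Idl A) \<subseteq> V_S R S {f}"
    unfolding F_def by auto
  have "(\<Union>f\<in>carrier R - Q. V_S R S {f}) = V_S R S {f}"
  proof
    show "(\<Union>f\<in>carrier R - Q. V_S R S {f}) \<subseteq> V_S R S {f}"
      using f(2) unfolding F[symmetric] U .
  qed (use f(1) in auto)
  then show ?thesis using Lambda_S_prime[OF Q] f(1) unfolding D_S_def by auto
qed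

text \<open>A Zariski open set is stable under generization, so together with a point it contains \<open>\<Lambda>(Q)\<close> for
  the prime \<open>Q\<close> of that point.  By hypothesis \<open>\<Lambda>(Q)\<close> is itself a Zariski open neighbourhood of the
  point, and it serves all members of the intersection at once.\<close>

lemma Lambda_principal_imp_Zariski_Inter:
  assumes princ: "\<And>Q. primeideal Q R \<Longrightarrow> Q \<inter> S = {} \<Longrightarrow> \<exists>f\<in>carrier R. Lambda_S R S Q = D_S R S f"
    and ne: "\<U> \<noteq> {}" and op: "\<And>U. U \<in> \<U> \<Longrightarrow> openin (S_Zariski_topology R S) U"
  shows "openin (S_Zariski_topology R S) (\<Inter>\<U>)"
  unfolding openin_subopen[of _ "\<Inter>\<U>"]
proof
  fix P assume P: "P \<in> \<Inter>\<U>"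
  obtain U where U: "U \<in> \<U>" using ne by auto
  have "P \<in> U" using P U by simp
  then have PS: "P \<in> S_Spec R S" using op[OF U] unfolding openin_Zariski_iff by auto
  obtain Q where Q: "primeideal Q R" "Q \<inter> S = {}"
    and V: "\<And>E. E \<subseteq> carrier R \<Longrightarrow> P \<in> V_S R S E \<longleftrightarrow> E \<subseteq> Q"
    using S_prime_associated_prime[OF PS] by metis
  obtain f where f: "f \<in> carrier R" "Lambda_S R S Q = D_S R S f" using princ[OF Q] by metis
  have "P \<in> Lambda_S R S Q" unfolding Lambda_S_prime[OF Q] using PS V by auto
  moreover have "Lambda_S R S Q \<subseteq> U" if U: "U \<in> \<U>" for U
  proof -
    obtain E where E: "E \<subseteq> carrier R" "U = S_Spec R S - V_S R S E"
      using op[OF U] unfolding openin_Zariski_iff by metis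
    have "P \<in> U" using P U by simp
    then have "\<not> E \<subseteq> Q" using V[OF E(1)] E(2) by simp
    then obtain e where e: "e \<in> E" "e \<in> carrier R - Q" using E(1) by auto
    then show ?thesis
      unfolding Lambda_S_prime[OF Q] E(2) using in_V_S_iff_elements[OF _ E(1)] by auto
  qed
  ultimately show "\<exists>T. openin (S_Zariski_topology R S) T \<and> P \<in> T \<and> T \<subseteq> \<Inter>\<U>"
    using openin_Zariski_D_S f by (intro exI[of _ "D_S R S f"]) auto
qed

text \<open>The union of an ascending chain of flat open sets is a union of basic sets \<open>V\<^sub>S(A)\<close>, each inside some
  stage of the chain.  The hypothesis makes this union Zariski closed, so by compactness it is already
  contained in one such \<open>V\<^sub>S(A)\<close>, hence in one stage.\<close>

lemma Zariski_Inter_imp_noetherian: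
  assumes Inter: "\<And>\<U>. \<U> \<noteq> {} \<Longrightarrow> (\<And>U. U \<in> \<U> \<Longrightarrow> openin (S_Zariski_topology R S) U) \<Longrightarrow>
      openin (S_Zariski_topology R S) (\<Inter>\<U>)"
  shows "noetherian_space (S_flat_topology R S)"
  unfolding noetherian_space_def
proof (intro allI impI, elim conjE)
  fix U :: "nat \<Rightarrow> 'a set set"
  assume op: "\<forall>n. openin (S_flat_topology R S) (U n)" and inc: "\<forall>n. U n \<subseteq> U (Suc n)"
  have mono: "U m \<subseteq> U n" if "m \<le> n" for m n
    using inc that by (simp add: lift_Suc_mono_le)
  define F where "F = {A. finite A \<and> A \<subseteq> carrier R \<and> (\<exists>n. V_S R S A \<subseteq> U n)}"
  have ne: "{\<one>} \<in> F" unfolding F_def by (simp add: V_S_one)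
  have UF: "(\<Union>n. U n) = (\<Union>A\<in>F. V_S R S A)"
  proof
    show "(\<Union>n. U n) \<subseteq> (\<Union>A\<in>F. V_S R S A)"
    proof
      fix P assume "P \<in> (\<Union>n. U n)"
      then obtain n where P: "P \<in> U n" by auto
      obtain A where "finite A" "A \<subseteq> carrier R" "P \<in> V_S R S A" "V_S R S A \<subseteq> U n"
        by (rule flat_open_basis[OF op[rule_format] P])
      then show "P \<in> (\<Union>A\<in>F. V_S R S A)" unfolding F_def by auto
    qed
  qed (auto simp: F_def)
  have "openin (S_Zariski_topology R S) (\<Inter>A\<in>F. S_Spec R S - V_S R S A)"
  proof (rule Inter)
    show "(\<lambda>A. S_Spec R S - V_S R S A) ` F \<noteq> {}" using ne by auto
    show "openin (S_Zariski_topology R S) W" if "W \<in> (\<lambda>A. S_Spec R S - V_S R S A) ` F" for W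
      using that unfolding openin_Zariski_iff F_def by auto
  qed
  moreover have "(\<Inter>A\<in>F. S_Spec R S - V_S R S A) = S_Spec R S - (\<Union>A\<in>F. V_S R S A)"
    using ne by auto
  ultimately obtain E where E: "E \<subseteq> carrier R"
    and EF: "S_Spec R S - (\<Union>A\<in>F. V_S R S A) = S_Spec R S - V_S R S E"
    unfolding openin_Zariski_iff by auto
  have "(\<Union>A\<in>F. V_S R S A) \<subseteq> S_Spec R S"
    by (rule UN_least) (rule V_S_subset_S_Spec)
  then have "(\<Union>A\<in>F. V_S R S A) = V_S R S E"
    using EF V_S_subset_S_Spec[of E] by (metis double_diff subset_refl)
  then have eq: "(\<Union>A\<in>F. V_S R S A) = V_S R S (Idl E)" using V_S_genideal[OF E] by simp
  have "\<exists>A\<in>F. V_S R S (Idl E) \<subseteq> V_S R S A"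
  proof (rule V_S_compact[OF genideal_ideal[OF E]])
    show "F \<noteq> {}" using ne by auto
    show "A <#> B \<in> F" if AB: "A \<in> F" "B \<in> F" for A B
    proof -
      obtain m n where mn: "V_S R S A \<subseteq> U m" "V_S R S B \<subseteq> U n" using AB unfolding F_def by auto
      have "V_S R S (A <#> B) = V_S R S A \<union> V_S R S B"
        using AB unfolding F_def by (intro V_S_set_mult) auto
      then have "V_S R S (A <#> B) \<subseteq> U (max m n)"
        using mn mono[of m "max m n"] mono[of n "max m n"] by auto
      moreover have "finite (A <#> B)" using AB unfolding F_def set_mult_def by auto
      moreover have "A <#> B \<subseteq> carrier R"
        using AB set_mult_closed[of A B] unfolding F_def by simp
      ultimately show ?thesis unfolding F_def by auto
    qed
    show "V_S R S (Idl E) \<subseteq> (\<Union>A\<in>F. V_S R S A)" using eq by simp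
  qed (auto simp: F_def)
  then obtain N where N: "V_S R S (Idl E) \<subseteq> U N" unfolding F_def by auto
  have "U n \<subseteq> U N" for n using UF eq N by auto
  then show "\<exists>N. \<forall>n\<ge>N. U n = U N" using mono by (meson subset_antisym)
qed

end

theorem theorem6p2:
  fixes R :: "('a, 'b) ring_scheme" and S :: "'a set"
  assumes "cring R" and "\<one>\<^bsub>R\<^esub> \<noteq> \<zero>\<^bsub>R\<^esub>" and "mult_closed_subset R S"
  shows
    "(noetherian_space (S_flat_topology R S)
       \<longleftrightarrow> {U. openin (S_flat_topology R S) U} = {V_S R S I | I. fg_ideal R I}) \<and>
     ({U. openin (S_flat_topology R S) U} = {V_S R S I | I. fg_ideal R I}
       \<longleftrightarrow> (\<forall>P. primeideal P R \<and> P \<inter> S = {} \<longrightarrow>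
             (\<exists>f\<in>carrier R. Lambda_S R S P = D_S R S f))) \<and>
     ((\<forall>P. primeideal P R \<and> P \<inter> S = {} \<longrightarrow>
             (\<exists>f\<in>carrier R. Lambda_S R S P = D_S R S f))
       \<longleftrightarrow> (\<forall>\<U>. \<U> \<noteq> {} \<and> (\<forall>U\<in>\<U>. openin (S_Zariski_topology R S) U) \<longrightarrow>
             openin (S_Zariski_topology R S) (\<Inter>\<U>)))"
    (is "(?N \<longleftrightarrow> ?B) \<and> (?B \<longleftrightarrow> ?L) \<and> (?L \<longleftrightarrow> ?Z)")
proof -
  interpret mult_closed_cring R S
    using assms(1,3) by (simp add: mult_closed_cring_def mult_closed_cring_axioms_def)
  have collect: "{U. p U} = {v A | A. q A} \<longleftrightarrow> (\<forall>U. p U \<longrightarrow> (\<exists>A. q A \<and> U = v A))"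
    if "\<And>A. q A \<Longrightarrow> p (v A)" for p q and v :: "'a set \<Rightarrow> 'a set set"
    using that by blast
  have B: "?B \<longleftrightarrow> (\<forall>U. openin (S_flat_topology R S) U \<longrightarrow>
      (\<exists>A. finite A \<and> A \<subseteq> carrier R \<and> U = V_S R S A))"
    unfolding V_S_fg_ideals
    by (rule collect[where q = "\<lambda>A. finite A \<and> A \<subseteq> carrier R", unfolded conj_assoc])
      (simp add: openin_flat_V_S)
  have "?N \<Longrightarrow> ?B"
    unfolding B by (intro allI impI noetherian_flat_open_is_basic)
  moreover have ?L if ?B
  proof (intro allI impI)
    have basic: "\<exists>A. finite A \<and> A \<subseteq> carrier R \<and> U = V_S R S A"
      if "openin (S_flat_topology R S) U" for U
      using \<open>?B\<close> that unfolding B by simp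
    fix P assume "primeideal P R \<and> P \<inter> S = {}"
    then show "\<exists>f\<in>carrier R. Lambda_S R S P = D_S R S f"
      using flat_opens_basic_imp_Lambda_principal[OF basic] by simp
  qed
  moreover have "?L \<Longrightarrow> ?Z"
    using Lambda_principal_imp_Zariski_Inter by simp
  moreover have "?Z \<Longrightarrow> ?N"
    using Zariski_Inter_imp_noetherian by simp
  ultimately show ?thesis by argo
qed

end
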